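(* Let $n,m\in\mathbb{N}$ and let $\varrho\in C^2(\mathbb{C};\mathbb{C})$ be neither holomorphic, nor antiholomorphic, nor $\mathbb{R}$-affine. Then $\mathcal{NN}^\varrho_{n,m,2n+2m+5}$ is universal. Moreover, if there is a point $z_0\in\mathbb{C}$ with either $\partial_{\mathrm{wirt}}\varrho(z_0)\neq0=\overline{\partial}_{\mathrm{wirt}}\varrho(z_0)$ or $\partial_{\mathrm{wirt}}\varrho(z_0)=0\neq\overline{\partial}_{\mathrm{wirt}}\varrho(z_0)$, then $\mathcal{NN}^\varrho_{n,m,n+m+4}$ is universal.
   Context: For $\varrho:\mathbb{C}\to\mathbb{C}$ and $n,m,W\in\mathbb{N}$, $\mathcal{NN}^\varrho_{n,m,W}$ denotes the set of all functions $\mathbb{C}^n\to\mathbb{C}^m$ of the form $V_L\circ\varrho^{\times W}\circ V_{L-1}\circ\cdots\circ\varrho^{\times W}\circ V_1$ with arbitrary depth $L\ge 2$, where $V_1:\mathbb{C}^n\to\mathbb{C}^W$, $V_2,\dots,V_{L-1}:\mathbb{C}^W\to\mathbb{C}^W$, $V_L:\mathbb{C}^W\to\mathbb{C}^m$ are $\mathbb{C}$-affine maps ($z\mapsto Az+b$ with complex $A,b$) and $\varrho^{\times W}$ applies $\varrho$ componentwise. A class $\mathcal{F}\subseteq C(\mathbb{C}^n;\mathbb{C}^m)$ is universal if for every $g\in C(\mathbb{C}^n;\mathbb{C}^m)$, compact $K\subseteq\mathbb{C}^n$ and $\varepsilon>0$ there is $f\in\mathcal{F}$ with $\sup_{z\in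 K}\|f(z)-g(z)\|<\varepsilon$. Wirtinger derivatives: $\partial_{\mathrm{wirt}}\varrho=\frac12(\partial_x\varrho-\mathrm{i}\partial_y\varrho)$, $\overline{\partial}_{\mathrm{wirt}}\varrho=\frac12(\partial_x\varrho+\mathrm{i}\partial_y\varrho)$. $\varrho$ is antiholomorphic if $\overline{\varrho}$ is holomorphic; $\varrho$ is $\mathbb{R}$-affine if it is affine as a map $\mathbb{R}^2\to\mathbb{R}^2$ under $\mathbb{C}\cong\mathbb{R}^2$. *)

theory Defs
  imports "HOL-Analysis.Analysis"
begin

definition C2_real :: "(complex \<Rightarrow> complex) \<Rightarrow> bool" where
  "C2_real f \<longleftrightarrow>
     (\<exists>(f' :: complex \<Rightarrow> complex \<Rightarrow>\<^sub>L complex)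
        (f'' :: complex \<Rightarrow> complex \<Rightarrow>\<^sub>L (complex \<Rightarrow>\<^sub>L complex)).
        (\<forall>z. (f has_derivative blinfun_apply (f' z)) (at z)) \<and>
        (\<forall>z. (f' has_derivative blinfun_apply (f'' z)) (at z)) \<and>
        continuous_on UNIV f'')"

text \<open>Wirtinger derivatives: partial_x f = Df(z) 1, partial_y f = Df(z) i.\<close>
definition wirt :: "(complex \<Rightarrow> complex) \<Rightarrow> complex \<Rightarrow> complex" where
  "wirt f z = (frechet_derivative f (at z) 1
                - \<i> * frechet_derivative f (at z) \<i>) / 2"

definition cowirt :: "(complex \<Rightarrow> complex) \<Rightarrow> complex \<Rightarrow> complex" where
  "cowirt f z = (frechet_derivative f (at z) 1
                + \<i> * frechet_derivative f (at z) \<i>) / 2"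

definition antiholomorphic :: "(complex \<Rightarrow> complex) \<Rightarrow> bool" where
  "antiholomorphic f \<longleftrightarrow> (\<lambda>z. cnj (f z)) holomorphic_on UNIV"

definition R_affine :: "(complex \<Rightarrow> complex) \<Rightarrow> bool" where
  "R_affine f \<longleftrightarrow> (\<exists>L c. linear L \<and> (\<forall>z. f z = L z + c))"

text \<open>Hidden activations in C^W are represented as functions nat => complex,
  of which only the entries with index < W are used.  One hidden step
  z |-> rho^{xW}(A z + b) with A : C^W -> C^W complex-affine.\<close>
definition hidden_step ::
  "(complex \<Rightarrow> complex) \<Rightarrow> nat \<Rightarrow> (nat \<Rightarrow> complex) \<Rightarrow>
     (nat \<Rightarrow> nat \<Rightarrow> complex) \<times> (nat \<Rightarrow> complex) \<Rightarrow> (nat \<Rightarrow> complex)" where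
  "hidden_step \<rho> W h Ab = (\<lambda>k. \<rho> ((\<Sum>j<W. fst Ab k j * h j) + snd Ab k))"

text \<open>NN^rho_{n,m,W}: all maps C^n -> C^m of the form
  V_L o rho^{xW} o V_{L-1} o ... o rho^{xW} o V_1 with L >= 2;
  Vs lists the middle layers V_2, ..., V_{L-1} (so L = length Vs + 2).\<close>
definition NN :: "(complex \<Rightarrow> complex) \<Rightarrow> nat \<Rightarrow>
    ((complex ^ 'n :: finite) \<Rightarrow> (complex ^ 'm :: finite)) set" where
  "NN \<rho> W = {F. \<exists>(A1 :: nat \<Rightarrow> 'n \<Rightarrow> complex) (b1 :: nat \<Rightarrow> complex)
      (Vs :: ((nat \<Rightarrow> nat \<Rightarrow> complex) \<times> (nat \<Rightarrow> complex)) list)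
      (AL :: 'm \<Rightarrow> nat \<Rightarrow> complex) (bL :: 'm \<Rightarrow> complex).
      \<forall>x. F x = (\<chi> i. (\<Sum>j<W.
          AL i j * foldl (hidden_step \<rho> W)
                     (\<lambda>k. \<rho> ((\<Sum>j'\<in>UNIV. A1 k j' * x $ j') + b1 k)) Vs j) + bL i)}"

definition universal :: "((complex ^ 'n :: finite) \<Rightarrow> (complex ^ 'm :: finite)) set \<Rightarrow> bool" where
  "universal \<F> \<longleftrightarrow>
     (\<forall>g K \<epsilon>. continuous_on UNIV g \<and> compact K \<and> \<epsilon> > 0 \<longrightarrow>
        (\<exists>f\<in>\<F>. \<forall>z\<in>K. norm (f z - g z) < \<epsilon>))"

end

theory Submission
  imports Defs
begin

text \<open>
  Locally uniform limits of networks of a fixed width are closed under composition, under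
  affine maps on either side and under further limits.  Keep the input \<open>x\<close>, the accumulated output
  \<open>y\<close> and one scratch value \<open>r\<close> in registers.  First-order Taylor expansion of \<open>\<rho>\<close> yields the
  identity and complex conjugation with two neurons each (with one neuron, one of the two, where
  exactly one Wirtinger derivative vanishes), hence \<open>r \<mapsto> Re r\<close> with four.  As \<open>\<rho>\<close> is not
  \<open>\<real>\<close>-affine, a second difference of \<open>\<rho>\<close> in a suitable direction yields, with two neurons, a map
  that squares real numbers.  Repeated squaring of \<open>1 + Re r / 2 ^ k\<close> gives \<open>exp (Re r)\<close> in the
  limit, so every sum of terms \<open>exp (Re (a \<bullet> x)) w\<close> can be accumulated in \<open>y\<close>, and these sums are
  dense by the Stone-Weierstrass theorem.  Four neurons for \<open>r\<close> and one or two for each entry of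
  \<open>x\<close> and \<open>y\<close> suffice.
\<close>

subsection \<open>Locally uniform closure\<close>

text \<open>Continuity is demanded of the limit because members of \<open>F\<close> need not be
  continuous. Composing limits relies on uniform continuity of the outer limit on compact
  sets.\<close>

definition loc_unif_closure :: "('a::topological_space \<Rightarrow> 'b::real_normed_vector) set \<Rightarrow> ('a \<Rightarrow> 'b) set" where
  "loc_unif_closure F = {f. continuous_on UNIV f \<and>
     (\<forall>K \<epsilon>. compact K \<longrightarrow> \<epsilon> > 0 \<longrightarrow> (\<exists>g\<in>F. \<forall>x\<in>K. norm (g x - f x) < \<epsilon>))}"

lemma loc_unif_closureI:
  assumes "continuous_on UNIV f"
    and "\<And>K \<epsilon>. compact K \<Longrightarrow> \<epsilon> > 0 \<Longrightarrow> \<exists>g\<in>F. \<forall>x\<in>K. norm (g x - f x) < \<epsilon>"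
  shows "f \<in> loc_unif_closure F"
  using assms by (auto simp: loc_unif_closure_def)

lemma loc_unif_continuous: "f \<in> loc_unif_closure F \<Longrightarrow> continuous_on UNIV f"
  by (auto simp: loc_unif_closure_def)

lemma loc_unif_closureE:
  assumes "f \<in> loc_unif_closure F" "compact K" "\<epsilon> > 0"
  obtains g where "g \<in> F" "\<And>x. x \<in> K \<Longrightarrow> norm (g x - f x) < \<epsilon>"
proof -
  have "\<exists>g\<in>F. \<forall>x\<in>K. norm (g x - f x) < \<epsilon>" using assms by (simp add: loc_unif_closure_def)
  then show thesis using that by blast
qed

lemma universal_iff_loc_unif: "universal F \<longleftrightarrow> (\<forall>g. continuous_on UNIV g \<longrightarrow> g \<in> loc_unif_closure F)"
  unfolding universal_def loc_unif_closure_def by blast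

lemma loc_unif_closure_idem: "loc_unif_closure (loc_unif_closure F) \<subseteq> loc_unif_closure F"
proof
  fix f assume f: "f \<in> loc_unif_closure (loc_unif_closure F)"
  show "f \<in> loc_unif_closure F"
  proof (rule loc_unif_closureI)
    show "continuous_on UNIV f" using f by (rule loc_unif_continuous)
    fix K :: "'a set" and \<epsilon> :: real assume K: "compact K" and e: "\<epsilon> > 0"
    obtain g where g: "g \<in> loc_unif_closure F" "\<And>x. x \<in> K \<Longrightarrow> norm (g x - f x) < \<epsilon> / 2"
      using loc_unif_closureE[OF f K, of "\<epsilon> / 2"] e by auto
    obtain h where h: "h \<in> F" "\<And>x. x \<in> K \<Longrightarrow> norm (h x - g x) < \<epsilon> / 2"
      using loc_unif_closureE[OF g(1) K, of "\<epsilon> / 2"] e by auto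
    have "norm (h x - f x) < \<epsilon>" if "x \<in> K" for x
      using g(2)[OF that] h(2)[OF that] norm_diff_triangle_less by fastforce
    then show "\<exists>g\<in>F. \<forall>x\<in>K. norm (g x - f x) < \<epsilon>" using h(1) by blast
  qed
qed

text \<open>On \<open>K\<close> the error splits into that of \<open>g1\<close> at
  \<open>f1 x\<close> and the change of \<open>g\<close> between \<open>f1 x\<close> and
  \<open>f x\<close>. The second is small because \<open>g\<close> is uniformly continuous on a ball
  that contains both points.\<close>

lemma loc_unif_compose:
  fixes f :: "'a::topological_space \<Rightarrow> 'b::euclidean_space" and g :: "'b \<Rightarrow> 'c::real_normed_vector"
  assumes f: "f \<in> loc_unif_closure F" and g: "g \<in> loc_unif_closure G"
    and comp: "\<And>f g. f \<in> F \<Longrightarrow> g \<in> G \<Longrightarrow> g \<circ> f \<in> H"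
  shows "g \<circ> f \<in> loc_unif_closure H"
proof (rule loc_unif_closureI)
  show "continuous_on UNIV (g \<circ> f)"
    using loc_unif_continuous[OF f] loc_unif_continuous[OF g] continuous_on_compose continuous_on_subset by blast
  fix K :: "'a set" and \<epsilon> :: real assume K: "compact K" and e: "\<epsilon> > 0"
  have "compact (f ` K)"
    using K loc_unif_continuous[OF f] compact_continuous_image continuous_on_subset by blast
  then obtain R where R: "\<And>x. x \<in> K \<Longrightarrow> norm (f x) \<le> R"
    using compact_imp_bounded bounded_iff by (metis imageI)
  define L :: "'b set" where "L = cball 0 (R + 1)"
  have L: "compact L" by (simp add: L_def)
  have "uniformly_continuous_on L g"
    using L loc_unif_continuous[OF g] compact_uniformly_continuous continuous_on_subset by blast
  then obtain d where d: "d > 0"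
    "\<And>u v. u \<in> L \<Longrightarrow> v \<in> L \<Longrightarrow> dist u v < d \<Longrightarrow> dist (g u) (g v) < \<epsilon> / 2"
    unfolding uniformly_continuous_on_def using e by (metis half_gt_zero)
  obtain f1 where f1: "f1 \<in> F" "\<And>x. x \<in> K \<Longrightarrow> norm (f1 x - f x) < min d 1"
    using loc_unif_closureE[OF f K, of "min d 1"] d(1) by auto
  obtain g1 where g1: "g1 \<in> G" "\<And>y. y \<in> L \<Longrightarrow> norm (g1 y - g y) < \<epsilon> / 2"
    using loc_unif_closureE[OF g L, of "\<epsilon> / 2"] e by auto
  have "norm ((g1 \<circ> f1) x - (g \<circ> f) x) < \<epsilon>" if x: "x \<in> K" for x
  proof -
    have fx: "f x \<in> L" using R[OF x] by (simp add: L_def)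
    have "norm (f1 x) \<le> norm (f x) + norm (f1 x - f x)" by (metis norm_triangle_sub)
    then have f1x: "f1 x \<in> L" using R[OF x] f1(2)[OF x] by (simp add: L_def)
    have "norm (g (f1 x) - g (f x)) < \<epsilon> / 2"
      using d(2)[OF f1x fx] f1(2)[OF x] by (simp add: dist_norm)
    then show ?thesis using g1(2)[OF f1x] norm_diff_triangle_less by fastforce
  qed
  then show "\<exists>h\<in>H. \<forall>x\<in>K. norm (h x - (g \<circ> f) x) < \<epsilon>" using comp[OF f1(1) g1(1)] by blast
qed

lemma loc_unif_self: "f \<in> F \<Longrightarrow> continuous_on UNIV f \<Longrightarrow> f \<in> loc_unif_closure F"
  by (rule loc_unif_closureI) (auto intro!: bexI[of _ f])

subsection \<open>Networks of fixed width\<close>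

definition affine_map :: "('q \<Rightarrow> 'p \<Rightarrow> complex) \<Rightarrow> ('q \<Rightarrow> complex) \<Rightarrow> complex ^ 'p::finite \<Rightarrow> complex ^ 'q::finite"
  where "affine_map A b x = (\<chi> i. (\<Sum>j\<in>UNIV. A i j * x $ j) + b i)"

lemma continuous_on_affine_map: "continuous_on S (affine_map A b)"
  unfolding affine_map_def by (intro continuous_intros)

text \<open>The output map of \<open>f\<close> followed by the input map of \<open>g\<close> is one
  affine map on C^W, so it serves as an additional middle layer. Depth grows, width does not, and
  the dimension of the space in between is arbitrary.\<close>

lemma NN_compose:
  assumes f: "f \<in> NN \<rho> W" and g: "g \<in> NN \<rho> W"
  shows "g \<circ> f \<in> NN \<rho> W"
proof -
  obtain A1 b1 Vs AL bL where f: "\<And>x. f x = (\<chi> i. (\<Sum>j<W.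
          AL i j * foldl (hidden_step \<rho> W)
                     (\<lambda>k. \<rho> ((\<Sum>j'\<in>UNIV. A1 k j' * x $ j') + b1 k)) Vs j) + bL i)"
    using f unfolding NN_def by blast
  obtain A1' b1' Vs' AL' bL' where g: "\<And>x. g x = (\<chi> i. (\<Sum>j<W.
          AL' i j * foldl (hidden_step \<rho> W)
                     (\<lambda>k. \<rho> ((\<Sum>j'\<in>UNIV. A1' k j' * x $ j') + b1' k)) Vs' j) + bL' i)"
    using g unfolding NN_def by blast
  define V where "V = (\<lambda>k j. \<Sum>i\<in>UNIV. A1' k i * AL i j, \<lambda>k. (\<Sum>i\<in>UNIV. A1' k i * bL i) + b1' k)"
  have V: "hidden_step \<rho> W h V =
      (\<lambda>k. \<rho> ((\<Sum>i\<in>UNIV. A1' k i * (\<chi> i. (\<Sum>j<W. AL i j * h j) + bL i) $ i) + b1' k))" for h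
  proof -
    have "(\<Sum>j<W. (\<Sum>i\<in>UNIV. A1' k i * AL i j) * h j) = (\<Sum>i\<in>UNIV. A1' k i * (\<Sum>j<W. AL i j * h j))" for k
      unfolding sum_distrib_right sum_distrib_left by (subst sum.swap) (simp add: mult.assoc)
    then show ?thesis
      by (simp add: hidden_step_def V_def distrib_left sum.distrib add.assoc)
  qed
  have "\<forall>x. (g \<circ> f) x = (\<chi> i. (\<Sum>j<W.
          AL' i j * foldl (hidden_step \<rho> W)
                     (\<lambda>k. \<rho> ((\<Sum>j'\<in>UNIV. A1 k j' * x $ j') + b1 k)) (Vs @ V # Vs') j) + bL' i)"
    by (simp add: g f V)
  then show ?thesis unfolding NN_def by blast
qed

lemma NN_compose_affine_map:
  assumes f: "f \<in> NN \<rho> W"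
  shows "f \<circ> affine_map A b \<in> NN \<rho> W"
proof -
  obtain A1 b1 Vs AL bL where f: "\<And>x. f x = (\<chi> i. (\<Sum>j<W.
          AL i j * foldl (hidden_step \<rho> W)
                     (\<lambda>k. \<rho> ((\<Sum>j'\<in>UNIV. A1 k j' * x $ j') + b1 k)) Vs j) + bL i)"
    using f unfolding NN_def by blast
  have "(\<Sum>i\<in>UNIV. A1 k i * affine_map A b x $ i) + b1 k =
     (\<Sum>j\<in>UNIV. (\<Sum>i\<in>UNIV. A1 k i * A i j) * x $ j) + ((\<Sum>i\<in>UNIV. A1 k i * b i) + b1 k)" for k x
  proof -
    have "(\<Sum>j\<in>UNIV. (\<Sum>i\<in>UNIV. A1 k i * A i j) * x $ j) = (\<Sum>i\<in>UNIV. A1 k i * (\<Sum>j\<in>UNIV. A i j * x $ j))"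
      unfolding sum_distrib_right sum_distrib_left by (subst sum.swap) (simp add: mult.assoc)
    then show ?thesis by (simp add: affine_map_def distrib_left sum.distrib add.assoc)
  qed
  then have "\<forall>x. (f \<circ> affine_map A b) x = (\<chi> i. (\<Sum>j<W.
          AL i j * foldl (hidden_step \<rho> W) (\<lambda>k. \<rho> ((\<Sum>j\<in>UNIV. (\<Sum>i\<in>UNIV. A1 k i * A i j) * x $ j)
             + ((\<Sum>i\<in>UNIV. A1 k i * b i) + b1 k))) Vs j) + bL i)"
    by (simp only: f comp_apply simp_thms)
  then show ?thesis unfolding NN_def mem_Collect_eq
    by (intro exI)
qed

lemma affine_map_compose_NN:
  assumes f: "f \<in> NN \<rho> W"
  shows "affine_map A b \<circ> f \<in> NN \<rho> W"
proof -
  obtain A1 b1 Vs AL bL where f: "\<And>x. f x = (\<chi> i. (\<Sum>j<W.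
          AL i j * foldl (hidden_step \<rho> W)
                     (\<lambda>k. \<rho> ((\<Sum>j'\<in>UNIV. A1 k j' * x $ j') + b1 k)) Vs j) + bL i)"
    using f unfolding NN_def by blast
  have "(\<Sum>i\<in>UNIV. A k i * ((\<Sum>j<W. AL i j * h j) + bL i)) + b k
      = (\<Sum>j<W. (\<Sum>i\<in>UNIV. A k i * AL i j) * h j) + ((\<Sum>i\<in>UNIV. A k i * bL i) + b k)" for h k
  proof -
    have "(\<Sum>j<W. (\<Sum>i\<in>UNIV. A k i * AL i j) * h j) = (\<Sum>i\<in>UNIV. A k i * (\<Sum>j<W. AL i j * h j))"
      unfolding sum_distrib_right sum_distrib_left by (subst sum.swap) (simp add: mult.assoc)
    then show ?thesis by (simp add: distrib_left sum.distrib add.assoc)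
  qed
  then have "\<forall>x. (affine_map A b \<circ> f) x = (\<chi> k. (\<Sum>j<W.
          (\<Sum>i\<in>UNIV. A k i * AL i j) * foldl (hidden_step \<rho> W) (\<lambda>k. \<rho> ((\<Sum>j'\<in>UNIV. A1 k j' * x $ j') + b1 k)) Vs j) 
            + ((\<Sum>i\<in>UNIV. A k i * bL i) + b k))"
    by (simp only: f affine_map_def comp_apply simp_thms vec_lambda_beta)
  then show ?thesis unfolding NN_def mem_Collect_eq
    by (intro exI)
qed

lemma shallow_in_NN:
  assumes I: "finite I" "card I \<le> W"
  shows "(\<lambda>x. \<chi> i. (\<Sum>s\<in>I. C i s * \<rho> ((\<Sum>j\<in>UNIV. A s j * x $ j) + b s)) + d i) \<in> NN \<rho> W"
proof -
  obtain h where h: "bij_betw h {..<card I} I"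
    using ex_bij_betw_nat_finite[OF I(1)] by (auto simp: atLeast0LessThan)
  \<comment> \<open>Neurons from \<open>card I\<close> up to \<open>W\<close> get output weight 0,
    so the values of \<open>h\<close> there do not matter.\<close>
  define AL where "AL i k = (if k < card I then C i (h k) else 0)" for i k
  have "(\<Sum>s\<in>I. C i s * \<rho> ((\<Sum>j\<in>UNIV. A s j * x $ j) + b s)) =
      (\<Sum>k<W. AL i k * \<rho> ((\<Sum>j\<in>UNIV. A (h k) j * x $ j) + b (h k)))" for i x
  proof -
    have "(\<Sum>s\<in>I. C i s * \<rho> ((\<Sum>j\<in>UNIV. A s j * x $ j) + b s)) =
       (\<Sum>k<card I. AL i k * \<rho> ((\<Sum>j\<in>UNIV. A (h k) j * x $ j) + b (h k)))"
      by (subst sum.reindex_bij_betw[OF h, symmetric]) (simp add: AL_def)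
    also have "\<dots> = (\<Sum>k<W. AL i k * \<rho> ((\<Sum>j\<in>UNIV. A (h k) j * x $ j) + b (h k)))"
      by (rule sum.mono_neutral_left) (use I(2) in \<open>auto simp: AL_def\<close>)
    finally show ?thesis .
  qed
  then have "\<forall>x. (\<chi> i. (\<Sum>s\<in>I. C i s * \<rho> ((\<Sum>j\<in>UNIV. A s j * x $ j) + b s)) + d i)
     = (\<chi> i. (\<Sum>k<W. AL i k * foldl (hidden_step \<rho> W)
          (\<lambda>k. \<rho> ((\<Sum>j\<in>UNIV. A (h k) j * x $ j) + b (h k))) [] k) + d i)"
    by simp
  then show ?thesis unfolding NN_def mem_Collect_eq
    by (intro exI)
qed

lemma loc_unif_NN_compose:
  "f \<in> loc_unif_closure (NN \<rho> W) \<Longrightarrow> g \<in> loc_unif_closure (NN \<rho> W) \<Longrightarrow> g \<circ> f \<in> loc_unif_closure (NN \<rho> W)"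
  by (rule loc_unif_compose) (auto intro: NN_compose)

lemma loc_unif_NN_compose_affine_map:
  "f \<in> loc_unif_closure (NN \<rho> W) \<Longrightarrow> f \<circ> affine_map A b \<in> loc_unif_closure (NN \<rho> W)"
  using loc_unif_compose[OF loc_unif_self[OF singletonI continuous_on_affine_map]] NN_compose_affine_map by blast

lemma affine_map_compose_loc_unif_NN:
  "f \<in> loc_unif_closure (NN \<rho> W) \<Longrightarrow> affine_map A b \<circ> f \<in> loc_unif_closure (NN \<rho> W)"
  using loc_unif_compose[OF _ loc_unif_self[OF singletonI continuous_on_affine_map]] affine_map_compose_NN by blast

section \<open>Scalar networks with one hidden layer, and running them side by side\<close>

definition scalar_nets :: "(complex \<Rightarrow> complex) \<Rightarrow> nat \<Rightarrow> (complex \<Rightarrow> complex) set" where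
  "scalar_nets \<rho> k = {f. \<exists>a b c d. \<forall>z. f z = (\<Sum>s<k. c s * \<rho> (a s * z + b s)) + d}"

lemma scalar_nets_lincomb:
  assumes f: "f \<in> scalar_nets \<rho> j" and g: "g \<in> scalar_nets \<rho> k"
  shows "(\<lambda>z. u * f z + v * g z) \<in> scalar_nets \<rho> (j + k)"
proof -
  obtain a b c d where f: "\<And>z. f z = (\<Sum>s<j. c s * \<rho> (a s * z + b s)) + d"
    using f unfolding scalar_nets_def by blast
  obtain a' b' c' d' where g: "\<And>z. g z = (\<Sum>s<k. c' s * \<rho> (a' s * z + b' s)) + d'"
    using g unfolding scalar_nets_def by blast
  \<comment> \<open>Indices below \<open>j\<close> address the neurons of \<open>f\<close>, the
    remaining \<open>k\<close> those of \<open>g\<close>.\<close>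
  define glue where "glue p q s = (if s < j then p s else q (s - j))" for p q :: "nat \<Rightarrow> complex" and s
  have "(\<Sum>s<j+k. glue (\<lambda>s. u * c s) (\<lambda>s. v * c' s) s * \<rho> (glue a a' s * z + glue b b' s))
     = u * (\<Sum>s<j. c s * \<rho> (a s * z + b s)) + v * (\<Sum>s<k. c' s * \<rho> (a' s * z + b' s))" for z
  proof -
    have "(\<Sum>s<j+k. F s) = (\<Sum>s<j. F s) + (\<Sum>s<k. F (s + j))" for F :: "nat \<Rightarrow> complex"
      using sum.atLeastLessThan_concat[of 0 j "j+k" F] sum.shift_bounds_nat_ivl[of F 0 j k]
      by (simp add: atLeast0LessThan add.commute)
    then show ?thesis by (simp add: glue_def sum_distrib_left mult.assoc)
  qed
  then have "\<forall>z. u * f z + v * g z = (\<Sum>s<j+k. glue (\<lambda>s. u * c s) (\<lambda>s. v * c' s) s *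
       \<rho> (glue a a' s * z + glue b b' s)) + (u * d + v * d')"
    by (simp add: f g algebra_simps)
  then show ?thesis unfolding scalar_nets_def mem_Collect_eq by (intro exI)
qed

lemma loc_unif_scalar_nets_lincomb:
  assumes f: "f \<in> loc_unif_closure (scalar_nets \<rho> j)" and g: "g \<in> loc_unif_closure (scalar_nets \<rho> k)"
  shows "(\<lambda>z. u * f z + v * g z) \<in> loc_unif_closure (scalar_nets \<rho> (j + k))"
proof (rule loc_unif_closureI)
  show "continuous_on UNIV (\<lambda>z. u * f z + v * g z)"
    by (intro continuous_intros loc_unif_continuous[OF f] loc_unif_continuous[OF g])
  fix K :: "complex set" and \<epsilon> :: real assume K: "compact K" and e: "\<epsilon> > 0"
  \<comment> \<open>The summand 1 keeps the denominator positive when \<open>u = v = 0\<close> and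
    makes the final estimate strict.\<close>
  define d where "d = \<epsilon> / (norm u + norm v + 1)"
  have pos: "norm u + norm v + 1 > 0" by (simp add: add_nonneg_pos)
  then have d: "d > 0" using e by (simp add: d_def)
  obtain f1 where f1: "f1 \<in> scalar_nets \<rho> j" "\<And>x. x \<in> K \<Longrightarrow> norm (f1 x - f x) < d"
    using loc_unif_closureE[OF f K d] by auto
  obtain g1 where g1: "g1 \<in> scalar_nets \<rho> k" "\<And>x. x \<in> K \<Longrightarrow> norm (g1 x - g x) < d"
    using loc_unif_closureE[OF g K d] by auto
  have "norm (u * f1 x + v * g1 x - (u * f x + v * g x)) < \<epsilon>" if x: "x \<in> K" for x
  proof -
    have "u * f1 x + v * g1 x - (u * f x + v * g x) = u * (f1 x - f x) + v * (g1 x - g x)"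
      by (simp add: algebra_simps)
    then have "norm (u * f1 x + v * g1 x - (u * f x + v * g x)) 
        \<le> norm u * norm (f1 x - f x) + norm v * norm (g1 x - g x)"
      by (metis norm_triangle_ineq norm_mult)
    also have "\<dots> \<le> norm u * d + norm v * d"
      using f1(2)[OF x] g1(2)[OF x] by (intro add_mono mult_left_mono) auto
    also have "\<dots> < (norm u + norm v + 1) * d" using d by (simp add: algebra_simps)
    also have "\<dots> = \<epsilon>" using pos by (simp add: d_def)
    finally show ?thesis .
  qed
  then show "\<exists>h\<in>scalar_nets \<rho> (j + k). \<forall>x\<in>K. norm (h x - (u * f x + v * g x)) < \<epsilon>"
    by (intro bexI[OF _ scalar_nets_lincomb[OF f1(1) g1(1), of u v]]) simp
qed

lemma loc_unif_scalar_nets_mono: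
  assumes "f \<in> loc_unif_closure (scalar_nets \<rho> j)" "j \<le> k"
  shows "f \<in> loc_unif_closure (scalar_nets \<rho> k)"
proof -
  have "(\<lambda>z. 0) \<in> scalar_nets \<rho> (k - j)"
    unfolding scalar_nets_def by (auto intro!: exI[of _ "\<lambda>_. 0"] exI[of _ 0])
  then have "(\<lambda>z. 0) \<in> loc_unif_closure (scalar_nets \<rho> (k - j))" by (rule loc_unif_self) simp
  from loc_unif_scalar_nets_lincomb[OF assms(1) this, of 1 1] show ?thesis using assms(2) by simp
qed

text \<open>Networks acting on different coordinates do not interact, so their neurons can be placed
  next to each other in one hidden layer. This is where neurons are counted: the width is the sum of
  the scalar widths.\<close>

lemma coordinatewise_in_loc_unif_NN:
  fixes T :: "'p::finite \<Rightarrow> complex \<Rightarrow> complex"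
  assumes T: "\<And>i. T i \<in> loc_unif_closure (scalar_nets \<rho> (k i))" and W: "(\<Sum>i\<in>UNIV. k i) \<le> W"
  shows "(\<lambda>v. \<chi> i. T i (v $ i)) \<in> loc_unif_closure (NN \<rho> W)"
proof (rule loc_unif_closureI)
  have "continuous_on UNIV (\<lambda>v::complex^'p. T i (v $ i))" for i
    by (rule continuous_on_compose2[OF loc_unif_continuous[OF T[of i]]]) (intro continuous_intros, simp)
  then show "continuous_on UNIV (\<lambda>v. \<chi> i. T i (v $ i))"
    by (intro continuous_intros)
  fix K :: "(complex^'p) set" and \<epsilon> :: real assume K: "compact K" and e: "\<epsilon> > 0"
  obtain R where R: "\<And>x. x \<in> K \<Longrightarrow> norm x \<le> R"
    using K compact_imp_bounded bounded_iff by metis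
  define d where "d = \<epsilon> / real CARD('p)"
  have d: "d > 0" using e by (simp add: d_def)
  have "\<exists>g\<in>scalar_nets \<rho> (k i). \<forall>z\<in>cball 0 R. norm (g z - T i z) < d" for i
    using loc_unif_closureE[OF T[of i] compact_cball d] by metis
  then obtain g where g: "\<And>i. g i \<in> scalar_nets \<rho> (k i)"
      "\<And>i z. z \<in> cball 0 R \<Longrightarrow> norm (g i z - T i z) < d" by metis
  have "\<exists>a b c d. \<forall>z. g i z = (\<Sum>s<k i. c s * \<rho> (a s * z + b s)) + d" for i
    using g(1)[of i] unfolding scalar_nets_def by blast
  then obtain a b c d0 where gi: "\<And>i z. g i z = (\<Sum>s<k i. c i s * \<rho> (a i s * z + b i s)) + d0 i"
    by metis
  \<comment> \<open>Neuron \<open>(i, s)\<close> reads coordinate \<open>i\<close> only and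
    contributes to output \<open>i\<close> only.\<close>
  define I where "I = Sigma (UNIV :: 'p set) (\<lambda>i. {..<k i})"
  have I: "finite I" "card I \<le> W" using W by (auto simp: I_def card_SigmaI)
  have "(\<chi> i. g i (v $ i)) = (\<chi> i. (\<Sum>s\<in>I. (if fst s = i then c i (snd s) else 0) *
       \<rho> ((\<Sum>j\<in>UNIV. (if fst s = j then a j (snd s) else 0) * v $ j) + b (fst s) (snd s))) + d0 i)"
    for v :: "complex^'p"
  proof -
    have "(\<Sum>s\<in>I. (if fst s = i then c i (snd s) else 0) *
       \<rho> ((\<Sum>j\<in>UNIV. (if fst s = j then a j (snd s) else 0) * v $ j) + b (fst s) (snd s)))
       = (\<Sum>s\<in>I. if fst s = i then c i (snd s) * \<rho> (a i (snd s) * v $ i + b i (snd s)) else 0)" for i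
      by (rule sum.cong) (auto simp: if_distrib[where f = "\<lambda>t. t * _"] cong: if_cong)
    also have "\<dots> i = (\<Sum>j\<in>UNIV. \<Sum>s<k j. if j = i then c i s * \<rho> (a i s * v $ i + b i s) else 0)" for i
      unfolding I_def by (subst sum.Sigma) (auto simp: case_prod_beta)
    also have "\<dots> i = (\<Sum>j\<in>UNIV. if j = i then \<Sum>s<k i. c i s * \<rho> (a i s * v $ i + b i s) else 0)" for i
      by (rule sum.cong) auto
    also have "\<dots> i = (\<Sum>s<k i. c i s * \<rho> (a i s * v $ i + b i s))" for i by simp
    finally show ?thesis by (simp add: gi)
  qed
  then have mem: "(\<lambda>v::complex^'p. \<chi> i. g i (v $ i)) \<in> NN \<rho> W"
    using shallow_in_NN[OF I] by simp
  have "norm ((\<chi> i. g i (v $ i)) - (\<chi> i. T i (v $ i))) < \<epsilon>" if v: "v \<in> K" for v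
  proof -
    have *: "norm (g i (v $ i) - T i (v $ i)) < d" for i
      using R[OF v] Finite_Cartesian_Product.norm_nth_le[of v i] by (intro g(2)) auto
    have "norm ((\<chi> i. g i (v $ i)) - (\<chi> i. T i (v $ i))) \<le> (\<Sum>i\<in>UNIV. norm (g i (v $ i) - T i (v $ i)))"
      unfolding norm_vec_def by (rule order_trans[OF L2_set_le_sum]) auto
    also have "\<dots> < (\<Sum>i\<in>(UNIV::'p set). d)" using * by (intro sum_strict_mono) auto
    finally show ?thesis by (simp add: d_def)
  qed
  then show "\<exists>g\<in>NN \<rho> W. \<forall>v\<in>K. norm (g v - (\<chi> i. T i (v $ i))) < \<epsilon>" by (intro bexI[OF _ mem]) simp
qed

subsection \<open>Scalar maps obtained from Taylor expansion\<close>

text \<open>The difference quotient of \<rho> at \<open>z0\<close> with increment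
  \<open>t * (a * z)\<close> uses one neuron, as \<rho>(z0) is a constant. The step \<open>t\<close>
  is real because \<open>D\<close> is only real-linear; the complex factor \<open>a\<close> is kept
  free so that different choices can separate the complex-linear part of \<open>D\<close> from the
  antilinear one.\<close>

lemma deriv_in_loc_unif_scalar_nets:
  assumes D: "(\<rho> has_derivative D) (at z0)"
  shows "(\<lambda>z. D (a * z)) \<in> loc_unif_closure (scalar_nets \<rho> 1)"
proof (rule loc_unif_closureI)
  interpret D: bounded_linear D using D by (rule has_derivative_bounded_linear)
  show "continuous_on UNIV (\<lambda>z. D (a * z))" by (intro D.continuous_on continuous_intros)
  fix K :: "complex set" and \<epsilon> :: real assume K: "compact K" and e: "\<epsilon> > 0"
  have "compact ((*) a ` K)" by (intro compact_continuous_image continuous_intros K)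
  then obtain R where R: "\<And>z. z \<in> K \<Longrightarrow> norm (a * z) < R" "R > 0"
    using compact_imp_bounded bounded_pos_less by (metis imageI)
  obtain d where d: "d > 0" "\<And>h. norm h < d \<Longrightarrow> norm (\<rho> (z0 + h) - \<rho> z0 - D h) \<le> \<epsilon> / (2 * R) * norm h"
    using D[unfolded has_derivative_at_alt] e R(2)
    by (metis add_diff_cancel_left' divide_pos_pos mult_pos_pos zero_less_numeral)
  \<comment> \<open>With this \<open>t\<close> every increment has norm below \<open>d\<close>, so
    the first-order estimate applies on all of \<open>K\<close>.\<close>
  define t where "t = d / (2 * R)"
  have t: "t > 0" using d(1) R(2) by (simp add: t_def)
  define g where "g z = (\<Sum>s<(1::nat). (1 / of_real t) * \<rho> ((of_real t * a) * z + z0)) + (- \<rho> z0 / of_real t)" for z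
  have mem: "g \<in> scalar_nets \<rho> 1"
    unfolding scalar_nets_def g_def mem_Collect_eq by (intro exI allI) (rule refl)
  have "norm (g z - D (a * z)) < \<epsilon>" if z: "z \<in> K" for z
  proof -
    define h where "h = of_real t * (a * z)"
    have nh: "norm h = t * norm (a * z)" using t by (simp add: h_def norm_mult)
    also have "\<dots> < t * R" using R(1)[OF z] t by simp
    finally have hR: "norm h < t * R" .
    also have "\<dots> \<le> d" using d(1) R(2) by (simp add: t_def field_simps)
    finally have "norm (\<rho> (z0 + h) - \<rho> z0 - D h) \<le> \<epsilon> / (2 * R) * norm h" by (rule d(2))
    also have "\<dots> < \<epsilon> / (2 * R) * (t * R)" using hR e R(2) by (intro mult_strict_left_mono) auto
    also have "\<dots> \<le> \<epsilon> * t" using e t R(2) by simp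
    finally have *: "norm (\<rho> (z0 + h) - \<rho> z0 - D h) < \<epsilon> * t" .
    have "D h = of_real t * D (a * z)"
      using D.scaleR[of t "a * z"] by (simp add: h_def scaleR_conv_of_real)
    then have "g z - D (a * z) = (\<rho> (z0 + h) - \<rho> z0 - D h) / of_real t"
      using t by (simp add: g_def h_def field_simps)
    then have "norm (g z - D (a * z)) = norm (\<rho> (z0 + h) - \<rho> z0 - D h) / t"
      using t by (simp add: norm_divide)
    then show ?thesis using * t by (simp add: pos_divide_less_eq)
  qed
  then show "\<exists>g\<in>scalar_nets \<rho> 1. \<forall>z\<in>K. norm (g z - D (a * z)) < \<epsilon>" using mem by blast
qed

lemma has_derivative_wirt:
  assumes D: "(\<rho> has_derivative D) (at z)"
  shows "D h = wirt \<rho> z * h + cowirt \<rho> z * cnj h"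
proof -
  interpret D: bounded_linear D using D by (rule has_derivative_bounded_linear)
  have fd: "frechet_derivative \<rho> (at z) = D" using frechet_derivative_at[OF D] by simp
  have "D h = D (Re h *\<^sub>R 1 + Im h *\<^sub>R \<i>)"
    by (rule arg_cong[where f = D]) (simp add: complex_eq_iff)
  also have "\<dots> = of_real (Re h) * D 1 + of_real (Im h) * D \<i>"
    unfolding D.add D.scaleR by (simp add: scaleR_conv_of_real)
  also have "\<dots> = wirt \<rho> z * h + cowirt \<rho> z * cnj h"
    unfolding wirt_def cowirt_def fd
    by (simp add: complex_eq_iff field_simps)
  finally show ?thesis .
qed

text \<open>Replacing z by iz multiplies the complex-linear part of \<open>D\<close> by i and the
  antilinear part by -i. Hence D(z) - i D(iz) retains only the first, and D(z) + i D(iz) only the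
  second, which gives conjugation in the next lemma.\<close>

lemma id_in_loc_unif_scalar_nets_2:
  assumes D: "(\<rho> has_derivative D) (at z0)" and "wirt \<rho> z0 \<noteq> 0"
  shows "(\<lambda>z. z) \<in> loc_unif_closure (scalar_nets \<rho> 2)"
proof -
  let ?w = "wirt \<rho> z0"
  have "(\<lambda>z. (1 / (2 * ?w)) * D (1 * z) + (- \<i> / (2 * ?w)) * D (\<i> * z)) = (\<lambda>z. z)"
    using assms(2) unfolding has_derivative_wirt[OF D] by (auto simp: field_simps)
  with loc_unif_scalar_nets_lincomb[OF deriv_in_loc_unif_scalar_nets[OF D, of 1] deriv_in_loc_unif_scalar_nets[OF D, of \<i>],
      of "1 / (2 * ?w)" "- \<i> / (2 * ?w)"]
  show ?thesis by (simp add: numeral_2_eq_2)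
qed

lemma cnj_in_loc_unif_scalar_nets_2:
  assumes D: "(\<rho> has_derivative D) (at z0)" and "cowirt \<rho> z0 \<noteq> 0"
  shows "cnj \<in> loc_unif_closure (scalar_nets \<rho> 2)"
proof -
  let ?w = "cowirt \<rho> z0"
  have "(\<lambda>z. (1 / (2 * ?w)) * D (1 * z) + (\<i> / (2 * ?w)) * D (\<i> * z)) = cnj"
    using assms(2) unfolding has_derivative_wirt[OF D] by (auto simp: field_simps)
  with loc_unif_scalar_nets_lincomb[OF deriv_in_loc_unif_scalar_nets[OF D, of 1] deriv_in_loc_unif_scalar_nets[OF D, of \<i>],
      of "1 / (2 * ?w)" "\<i> / (2 * ?w)"]
  show ?thesis by (simp add: numeral_2_eq_2)
qed

lemma id_in_loc_unif_scalar_nets_1: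
  assumes D: "(\<rho> has_derivative D) (at z0)" and "wirt \<rho> z0 \<noteq> 0" "cowirt \<rho> z0 = 0"
  shows "(\<lambda>z. z) \<in> loc_unif_closure (scalar_nets \<rho> 1)"
  using deriv_in_loc_unif_scalar_nets[OF D, of "1 / wirt \<rho> z0"] assms(2,3)
  by (simp add: has_derivative_wirt[OF D])

lemma cnj_in_loc_unif_scalar_nets_1:
  assumes D: "(\<rho> has_derivative D) (at z0)" and "wirt \<rho> z0 = 0" "cowirt \<rho> z0 \<noteq> 0"
  shows "cnj \<in> loc_unif_closure (scalar_nets \<rho> 1)"
  \<comment> \<open>The inner factor comes out of \<open>D\<close> conjugated, hence the
    \<open>cnj\<close> in its denominator.\<close>
  using deriv_in_loc_unif_scalar_nets[OF D, of "1 / cnj (cowirt \<rho> z0)"] assms(2,3)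
  by (simp add: has_derivative_wirt[OF D])

text \<open>The mean value inequality on [0,1] is applied to the symmetric difference along
  \<open>h\<close> minus its expected quadratic term. The derivative of that function involves only
  f' at two points symmetric about \<open>z0\<close>, so differentiability of f' at
  \<open>z0\<close> bounds it.\<close>

lemma second_difference_bound:
  fixes f :: "complex \<Rightarrow> complex" and f' :: "complex \<Rightarrow> complex \<Rightarrow>\<^sub>L complex"
  assumes f: "\<And>z. (f has_derivative blinfun_apply (f' z)) (at z)"
    and f': "(f' has_derivative blinfun_apply f'') (at z0)" and e: "e > 0"
  obtains d where "d > 0"
    "\<And>h. norm h < d \<Longrightarrow> norm (f (z0 + h) + f (z0 - h) - 2 * f z0 - f'' h h) \<le> e * (norm h)\<^sup>2"
proof -
  obtain d where d: "d > 0" "\<And>h. norm h < d \<Longrightarrow> norm (f' (z0 + h) - f' z0 - f'' h) \<le> e / 2 * norm h"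
    using f'[unfolded has_derivative_at_alt] e by (metis add_diff_cancel_left' half_gt_zero)
  have "norm (f (z0 + h) + f (z0 - h) - 2 * f z0 - f'' h h) \<le> e * (norm h)\<^sup>2" if h: "norm h < d" for h
  proof -
    define \<phi> where "\<phi> s = f (z0 + s *\<^sub>R h) + f (z0 - s *\<^sub>R h) - s\<^sup>2 *\<^sub>R f'' h h" for s :: real
    define \<phi>' where "\<phi>' s = (f' (z0 + s *\<^sub>R h) - f' (z0 - s *\<^sub>R h) - (2 * s) *\<^sub>R f'' h) h" for s
    have D: "(\<phi> has_derivative (\<lambda>u. u *\<^sub>R \<phi>' s)) (at s within {0..1})" for s
    proof -
      have 1: "((\<lambda>s. f (z0 + s *\<^sub>R h)) has_derivative (\<lambda>u. f' (z0 + s *\<^sub>R h) (u *\<^sub>R h))) (at s within {0..1})"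
        by (rule has_derivative_compose[OF _ f]) (auto intro!: derivative_eq_intros)
      have 2: "((\<lambda>s. f (z0 - s *\<^sub>R h)) has_derivative (\<lambda>u. f' (z0 - s *\<^sub>R h) (- u *\<^sub>R h))) (at s within {0..1})"
        by (rule has_derivative_compose[OF _ f]) (auto intro!: derivative_eq_intros)
      have 3: "((\<lambda>s. s\<^sup>2 *\<^sub>R f'' h h) has_derivative (\<lambda>u. (2 * s * u) *\<^sub>R f'' h h)) (at s within {0..1})"
        by (auto intro!: derivative_eq_intros)
      show ?thesis unfolding \<phi>_def \<phi>'_def
        by (rule has_derivative_eq_rhs[OF has_derivative_diff[OF has_derivative_add[OF 1 2] 3]])
           (auto simp: blinfun.bilinear_simps algebra_simps)
    qed
    have B: "norm (\<phi>' s) \<le> e * (norm h)\<^sup>2" if s: "s \<in> {0..1}" for s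
    proof -
      have sh: "norm (s *\<^sub>R h) \<le> norm h" using s by (simp add: mult_left_le_one_le)
      then have sd: "norm (s *\<^sub>R h) < d" using h by simp
      \<comment> \<open>Both brackets are first-order remainders of f' at \<open>z0\<close>, for the
        increments sh and -sh; the terms \<open>f' z0\<close> cancel.\<close>
      have "f' (z0 + s *\<^sub>R h) - f' (z0 - s *\<^sub>R h) - (2 * s) *\<^sub>R f'' h =
          (f' (z0 + s *\<^sub>R h) - f' z0 - f'' (s *\<^sub>R h)) - (f' (z0 + - (s *\<^sub>R h)) - f' z0 - f'' (- (s *\<^sub>R h)))"
        by (simp add: blinfun.bilinear_simps algebra_simps flip: scaleR_2)
      also have "norm \<dots> \<le> e / 2 * norm (s *\<^sub>R h) + e / 2 * norm (- (s *\<^sub>R h))"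
        by (rule order_trans[OF norm_triangle_ineq4]) (intro add_mono d(2), use sd in auto)
      also have "\<dots> \<le> e * norm h" using sh e by simp
      finally show ?thesis unfolding \<phi>'_def power2_eq_square mult.assoc[symmetric]
        by (intro order_trans[OF norm_blinfun] mult_right_mono) auto
    qed
    have "norm (\<phi> 1 - \<phi> 0) \<le> e * (norm h)\<^sup>2 * norm (1 - 0 :: real)"
    proof (rule differentiable_bound)
      show "(\<phi> has_derivative (\<lambda>u. u *\<^sub>R \<phi>' s)) (at s within {0..1})" for s by (rule D)
      show "onorm (\<lambda>u. u *\<^sub>R \<phi>' s) \<le> e * (norm h)\<^sup>2" if "s \<in> {0..1}" for s
      proof (rule onorm_le)
        show "norm (u *\<^sub>R \<phi>' s) \<le> e * (norm h)\<^sup>2 * norm u" for u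
          using mult_left_mono[OF B[OF that], of "\<bar>u\<bar>"] by (simp add: ac_simps)
      qed
    qed auto
    then show ?thesis by (simp add: \<phi>_def algebra_simps)
  qed
  with d(1) show ?thesis by (rule that)
qed

text \<open>The two neurons evaluate \<rho> at \<open>z0 + h\<close> and \<open>z0 - h\<close> with
  h = tvz; the middle term of the second difference is a constant and goes into the bias. Dividing
  by the square of \<open>t\<close> gives the quadratic form in the limit.\<close>

lemma second_deriv_in_loc_unif_scalar_nets:
  fixes f' :: "complex \<Rightarrow> complex \<Rightarrow>\<^sub>L complex"
  assumes f: "\<And>z. (\<rho> has_derivative blinfun_apply (f' z)) (at z)"
    and f': "(f' has_derivative blinfun_apply f'') (at z0)"
  shows "(\<lambda>z. \<kappa> * f'' (v * z) (v * z)) \<in> loc_unif_closure (scalar_nets \<rho> 2)"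
proof (rule loc_unif_closureI)
  show "continuous_on UNIV (\<lambda>z. \<kappa> * f'' (v * z) (v * z))" by (intro continuous_intros)
  fix K :: "complex set" and \<epsilon> :: real assume K: "compact K" and e: "\<epsilon> > 0"
  have "compact ((*) v ` K)" by (intro compact_continuous_image continuous_intros K)
  then obtain R where R: "\<And>z. z \<in> K \<Longrightarrow> norm (v * z) < R" "R > 0"
    using compact_imp_bounded bounded_pos_less by (metis imageI)
  \<comment> \<open>After division by the square of \<open>t\<close> the error is at most |\<kappa>|
    e' R^2 = |\<kappa>| \<epsilon> / (|\<kappa>| + 1), which is below \<epsilon>.\<close>
  define e' where "e' = \<epsilon> / ((norm \<kappa> + 1) * R\<^sup>2)"
  have k1: "norm \<kappa> + 1 > 0" by (simp add: add_nonneg_pos)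
  have e': "e' > 0" using e R(2) k1 by (simp add: e'_def)
  obtain d where d: "d > 0" "\<And>h. norm h < d \<Longrightarrow>
     norm (\<rho> (z0 + h) + \<rho> (z0 - h) - 2 * \<rho> z0 - f'' h h) \<le> e' * (norm h)\<^sup>2"
    using second_difference_bound[OF f f' e'] by blast
  define t where "t = d / R"
  have t: "t > 0" using d(1) R(2) by (simp add: t_def)
  define g where "g z = (\<Sum>s<(2::nat). (\<kappa> / of_real (t\<^sup>2)) * \<rho> ((- 1) ^ s * of_real t * v * z + z0))
      + (- 2 * \<kappa> * \<rho> z0 / of_real (t\<^sup>2))" for z
  have mem: "g \<in> scalar_nets \<rho> 2"
    unfolding scalar_nets_def g_def mem_Collect_eq by (intro exI allI) (rule refl)
  have "norm (g z - \<kappa> * f'' (v * z) (v * z)) < \<epsilon>" if z: "z \<in> K" for z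
  proof -
    define h where "h = t *\<^sub>R (v * z)"
    have nh: "norm h = t * norm (v * z)" using t by (simp add: h_def)
    also have "\<dots> < t * R" using R(1)[OF z] t by simp
    finally have hR: "norm h < t * R" .
    also have "\<dots> = d" using R(2) by (simp add: t_def)
    finally have "norm (\<rho> (z0 + h) + \<rho> (z0 - h) - 2 * \<rho> z0 - f'' h h) \<le> e' * (norm h)\<^sup>2" by (rule d(2))
    also have "\<dots> \<le> e' * (t * R)\<^sup>2" using hR e' by (intro mult_left_mono power_mono) auto
    finally have *: "norm (\<rho> (z0 + h) + \<rho> (z0 - h) - 2 * \<rho> z0 - f'' h h) \<le> e' * (t * R)\<^sup>2" .
    have "f'' h h = of_real (t\<^sup>2) * f'' (v * z) (v * z)"
      unfolding h_def blinfun.bilinear_simps power2_eq_square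
      by (simp add: scaleR_conv_of_real mult.assoc)
    moreover have "g z = (\<kappa> / of_real (t\<^sup>2)) * (\<rho> (z0 + h) + \<rho> (z0 - h) - 2 * \<rho> z0)"
      using t by (simp add: g_def h_def numeral_2_eq_2 scaleR_conv_of_real algebra_simps add_divide_distrib diff_divide_distrib)
    ultimately have "g z - \<kappa> * f'' (v * z) (v * z)
        = (\<kappa> / of_real (t\<^sup>2)) * (\<rho> (z0 + h) + \<rho> (z0 - h) - 2 * \<rho> z0 - f'' h h)"
      using t by (simp add: field_simps)
    then have "norm (g z - \<kappa> * f'' (v * z) (v * z)) \<le> norm \<kappa> / t\<^sup>2 * (e' * (t * R)\<^sup>2)"
      using * t by (simp only: norm_mult norm_divide norm_of_real) (intro mult_mono, auto)
    also have "\<dots> = norm \<kappa> * (e' * R\<^sup>2)" using t by (simp add: power_mult_distrib)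
    also have "e' * R\<^sup>2 = \<epsilon> / (norm \<kappa> + 1)" using R(2) by (simp add: e'_def)
    also have "norm \<kappa> * \<dots> < \<epsilon>" using e k1 by (simp add: field_simps)
    finally show ?thesis .
  qed
  then show "\<exists>g\<in>scalar_nets \<rho> 2. \<forall>z\<in>K. norm (g z - \<kappa> * f'' (v * z) (v * z)) < \<epsilon>"
    using mem by blast
qed

text \<open>Along the line through 0 in direction \<open>v\<close>, the directional derivative
  \<open>f' (s *\<^sub>R v) v\<close> has derivative \<open>f'' (s *\<^sub>R v) v v\<close>, so it
  is constant and \<open>f\<close> is affine there with slope \<open>f' 0 v\<close>. These slopes
  fit together since \<open>f' 0\<close> is linear. The contrapositive supplies the direction for
  squaring.\<close>

lemma R_affine_if_second_deriv_vanishes: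
  fixes f' :: "complex \<Rightarrow> complex \<Rightarrow>\<^sub>L complex" and f'' :: "complex \<Rightarrow> complex \<Rightarrow>\<^sub>L complex \<Rightarrow>\<^sub>L complex"
  assumes f: "\<And>z. (f has_derivative blinfun_apply (f' z)) (at z)"
    and f': "\<And>z. (f' has_derivative blinfun_apply (f'' z)) (at z)"
    and vanish: "\<And>z v. f'' z v v = 0"
  shows "R_affine f"
proof -
  have "f v = f' 0 v + f 0" for v
  proof -
    have s: "((\<lambda>s. s *\<^sub>R v) has_derivative (\<lambda>u. u *\<^sub>R v)) (at s)" for s :: real
      by (auto intro!: derivative_eq_intros)
    have "((\<lambda>s. f' (s *\<^sub>R v) v) has_derivative (\<lambda>u. f'' (s *\<^sub>R v) (u *\<^sub>R v) v)) (at s)" for s :: real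
      by (intro bounded_linear.has_derivative[OF blinfun.bounded_linear_left] has_derivative_compose[OF s f'])
    then have "((\<lambda>s. f' (s *\<^sub>R v) v) has_derivative (\<lambda>u. 0)) (at s)" for s :: real
      by (simp add: blinfun.bilinear_simps vanish)
    then have f'c: "f' (s *\<^sub>R v) v = f' 0 v" for s :: real
      using has_derivative_zero_unique[of UNIV "\<lambda>s. f' (s *\<^sub>R v) v" s 0] by simp
    have "((\<lambda>s. f (s *\<^sub>R v) - s *\<^sub>R f' 0 v) has_derivative (\<lambda>u. f' (s *\<^sub>R v) (u *\<^sub>R v) - u *\<^sub>R f' 0 v)) (at s)" for s :: real
      by (intro has_derivative_diff has_derivative_compose[OF s f]) (auto intro!: derivative_eq_intros)
    then have "((\<lambda>s. f (s *\<^sub>R v) - s *\<^sub>R f' 0 v) has_derivative (\<lambda>u. 0)) (at s)" for s :: real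
      by (simp add: blinfun.bilinear_simps f'c)
    then have "f (1 *\<^sub>R v) - 1 *\<^sub>R f' 0 v = f (0 *\<^sub>R v) - 0 *\<^sub>R f' 0 v"
      using has_derivative_zero_unique[of UNIV "\<lambda>s. f (s *\<^sub>R v) - s *\<^sub>R f' 0 v" 1 0] by simp
    then show ?thesis by (simp add: algebra_simps)
  qed
  then show ?thesis unfolding R_affine_def
    using bounded_linear.linear[OF blinfun.bounded_linear_right] by blast
qed

text \<open>Were \<open>cowirt f\<close> zero everywhere, each derivative would be multiplication by
  a complex number, which is complex differentiability. The next lemma argues in the same way for
  the conjugate of \<open>f\<close>.\<close>

lemma ex_cowirt_nonzero:
  assumes "\<And>z. (f has_derivative D z) (at z)" "\<not> f holomorphic_on UNIV"
  obtains z where "cowirt f z \<noteq> 0"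
proof (rule ccontr)
  assume "\<not> thesis"
  then have "cowirt f z = 0" for z using that by blast
  then have "D z = (*) (wirt f z)" for z
    using has_derivative_wirt[OF assms(1)] by auto
  then have "(f has_field_derivative wirt f z) (at z)" for z
    using assms(1)[of z] by (simp add: has_field_derivative_def)
  then show False using assms(2) by (metis field_differentiable_at_within field_differentiable_def holomorphic_on_def)
qed

lemma ex_wirt_nonzero:
  assumes "\<And>z. (f has_derivative D z) (at z)" "\<not> antiholomorphic f"
  obtains z where "wirt f z \<noteq> 0"
proof (rule ccontr)
  assume "\<not> thesis"
  then have "wirt f z = 0" for z using that by blast
  then have "(\<lambda>h. cnj (D z h)) = (*) (cnj (cowirt f z))" for z
    using has_derivative_wirt[OF assms(1)] by auto
  then have "((\<lambda>z. cnj (f z)) has_field_derivative cnj (cowirt f z)) (at z)" for z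
    using has_derivative_cnj[OF assms(1)[of z]] by (simp add: has_field_derivative_def)
  then show False using assms(2) unfolding antiholomorphic_def
    by (metis field_differentiable_at_within field_differentiable_def holomorphic_on_def)
qed

subsection \<open>Density of sums of exponentials\<close>

text \<open>Real-valued functions suffice, since complex vectors enter later as coefficients. The
  inductive form lets a register program be built along the construction of the function.\<close>

inductive_set exp_span :: "(complex ^ 'n::finite \<Rightarrow> real) set" where
  exp: "(\<lambda>x. exp (Re (\<Sum>j\<in>UNIV. a j * x $ j))) \<in> exp_span"
| add: "f \<in> exp_span \<Longrightarrow> g \<in> exp_span \<Longrightarrow> (\<lambda>x. f x + g x) \<in> exp_span"
| scale: "f \<in> exp_span \<Longrightarrow> (\<lambda>x. c * f x) \<in> exp_span"

lemma exp_span_mult: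
  assumes "f \<in> exp_span" "g \<in> exp_span"
  shows "(\<lambda>x. f x * g x) \<in> exp_span"
  using assms(1)
proof induction
  case (exp a)
  show ?case using assms(2)
  proof induction
    case (exp b)
    have "(\<lambda>x. exp (Re (\<Sum>j\<in>UNIV. a j * x $ j)) * exp (Re (\<Sum>j\<in>UNIV. b j * x $ j))) =
        (\<lambda>x. exp (Re (\<Sum>j\<in>UNIV. (a j + b j) * x $ j)))"
      by (simp add: exp_add[symmetric] sum.distrib distrib_right del: Re_sum)
    then show ?case using exp_span.exp[of "\<lambda>j. a j + b j"] by simp
  next
    case (add f g)
    then show ?case using exp_span.add by (fastforce simp: distrib_left)
  next
    case (scale f c)
    then show ?case using exp_span.scale[OF scale.IH, of c] by (simp add: mult.left_commute)
  qed
next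
  case (add f h)
  then show ?case using exp_span.add by (fastforce simp: distrib_right)
next
  case (scale f c)
  then show ?case using exp_span.scale[OF scale.IH, of c] by (simp add: mult.assoc)
qed

lemma exp_span_continuous: "f \<in> exp_span \<Longrightarrow> continuous_on S f"
  by (induction rule: exp_span.induct) (auto intro!: continuous_intros simp del: Re_sum)

lemma exp_span_dense:
  fixes f :: "complex ^ 'n::finite \<Rightarrow> real"
  assumes "compact K" "continuous_on K f" "\<epsilon> > 0"
  obtains g where "g \<in> exp_span" "\<And>x. x \<in> K \<Longrightarrow> \<bar>f x - g x\<bar> < \<epsilon>"
proof -
  interpret function_ring_on "exp_span :: (complex ^ 'n \<Rightarrow> real) set" K
  proof
    show "compact K" by fact
    show "continuous_on K f" if "f \<in> exp_span" for f :: "complex ^ 'n \<Rightarrow> real"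
      using that by (rule exp_span_continuous)
    show "(\<lambda>_. c) \<in> exp_span" for c
      using exp_span.scale[OF exp_span.exp[of "\<lambda>_. 0"], of c] by simp
    fix x y :: "complex ^ 'n" assume "x \<noteq> y"
    then obtain i where i: "x $ i \<noteq> y $ i" by (metis vec_eq_iff)
    define F where "F c x = exp (Re (\<Sum>j\<in>UNIV. (if j = i then c else 0) * x $ j))"
      for c and x :: "complex ^ 'n"
    have F: "F c \<in> exp_span" for c unfolding F_def by (rule exp_span.exp)
    have Fx: "F c x = exp (Re (c * x $ i))" for c x
      unfolding F_def by (simp add: if_distrib[where f = "\<lambda>t. t * _"] del: Re_sum cong: if_cong)
    \<comment> \<open>The factor 1 detects a difference of the real parts, the factor i one of the
      imaginary parts.\<close>
    have "F 1 x \<noteq> F 1 y \<or> F \<i> x \<noteq> F \<i> y" using i by (auto simp: Fx complex_eq_iff)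
    then show "\<exists>f\<in>exp_span. f x \<noteq> f y" using F by blast
  qed (auto intro: exp_span.add exp_span_mult)
  show ?thesis using Stone_Weierstrass_basic[OF assms(2,3)] that by blast
qed

text \<open>For |u| at most 1/2, ln (1 + u) lies between u - 2u^2 and u. Multiplying by N and
  exponentiating encloses the power between exp t exp (-2Nu^2) and exp t. The bound depends on t
  only through R, hence is uniform on compact sets.\<close>

lemma exp_limit_bound:
  fixes t :: real
  assumes "\<bar>t\<bar> \<le> R" "N > 0" "2 * R \<le> real N"
  shows "\<bar>(1 + t / real N) ^ N - exp t\<bar> \<le> exp R * (2 * R\<^sup>2) / real N"
proof -
  define u where "u = t / real N"
  have N: "real N > 0" using assms(2) by simp
  have u: "\<bar>u\<bar> \<le> 1 / 2" using assms N by (simp add: u_def field_simps)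
  then have u1: "1 + u > 0" by linarith
  have tN: "t = real N * u" using N by (simp add: u_def)
  have pw: "(1 + u) ^ N = exp (real N * ln (1 + u))" using u1 by (simp add: exp_of_nat_mult)
  have up: "(1 + u) ^ N \<le> exp t"
    unfolding pw tN using ln_add_one_self_le_self2[of u] u N by simp
  have "ln (1 + u) \<ge> u - 2 * u\<^sup>2" using abs_ln_one_plus_x_minus_x_bound[OF u] by linarith
  then have "real N * ln (1 + u) \<ge> real N * (u - 2 * u\<^sup>2)" using N by simp
  then have "exp t * exp (- (2 * real N * u\<^sup>2)) \<le> (1 + u) ^ N"
    unfolding pw tN by (simp add: exp_add[symmetric] algebra_simps)
  moreover have "exp t * (1 - 2 * real N * u\<^sup>2) \<le> exp t * exp (- (2 * real N * u\<^sup>2))"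
    using exp_ge_add_one_self[of "- (2 * real N * u\<^sup>2)"] by simp
  ultimately have "exp t - (1 + u) ^ N \<le> exp t * (2 * real N * u\<^sup>2)" by (simp add: algebra_simps)
  also have "2 * real N * u\<^sup>2 = 2 * t\<^sup>2 / real N" using N by (simp add: u_def power2_eq_square field_simps)
  also have "exp t * (2 * t\<^sup>2 / real N) \<le> exp R * (2 * R\<^sup>2 / real N)"
    using assms(1) N abs_le_square_iff[of t R] by (intro mult_mono divide_right_mono) auto
  finally show ?thesis using up by (simp add: u_def)
qed

subsection \<open>Register machines\<close>

text \<open>The disjoint union as index type addresses each kind of register by its constructor and
  lets sums over all entries split accordingly.\<close>

definition pack :: "complex ^ 'n::finite \<Rightarrow> complex ^ 'm::finite \<Rightarrow> complex \<Rightarrow> complex ^ ('n + 'm + unit)" where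
  "pack x y r = (\<chi> i. case i of Inl j \<Rightarrow> x $ j | Inr (Inl j) \<Rightarrow> y $ j | Inr (Inr _) \<Rightarrow> r)"

definition on_registers :: "(complex \<Rightarrow> complex) \<Rightarrow> (complex \<Rightarrow> complex) \<Rightarrow>
    complex ^ ('n::finite + 'm::finite + unit) \<Rightarrow> complex ^ ('n + 'm + unit)" where
  "on_registers S T v = (\<chi> i. (case i of Inl _ \<Rightarrow> S | Inr (Inl _) \<Rightarrow> S | Inr (Inr _) \<Rightarrow> T) (v $ i))"

lemma on_registers_id_pack: "on_registers (\<lambda>z. z) T (pack x y r) = pack x y (T r)"
  by (simp add: on_registers_def pack_def vec_eq_iff split: sum.split)

lemma sum_UNIV_sum:
  fixes f :: "'a::finite + 'b::finite \<Rightarrow> 'c::comm_monoid_add"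
  shows "(\<Sum>i\<in>UNIV. f i) = (\<Sum>i\<in>UNIV. f (Inl i)) + (\<Sum>i\<in>UNIV. f (Inr i))"
  by (simp add: UNIV_Plus_UNIV[symmetric] sum.Plus del: UNIV_Plus_UNIV)

lemma pack_diff: "pack x y r - pack x y s = pack 0 0 (r - s)"
  by (simp add: pack_def vec_eq_iff split: sum.split)

lemma norm_pack_zero: "norm (pack 0 0 r) = norm r"
  by (simp add: pack_def norm_vec_def L2_set_def sum_UNIV_sum)

lemma on_registers_in_loc_unif_NN:
  assumes S: "S \<in> loc_unif_closure (scalar_nets \<rho> p)" and T: "T \<in> loc_unif_closure (scalar_nets \<rho> q)"
    and W: "p * CARD('n::finite) + p * CARD('m::finite) + q \<le> W"
  shows "(on_registers S T :: _ \<Rightarrow> complex ^ ('n + 'm + unit)) \<in> loc_unif_closure (NN \<rho> W)"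
  unfolding on_registers_def
proof (rule coordinatewise_in_loc_unif_NN)
  let ?k = "\<lambda>i :: 'n + 'm + unit. case i of Inl _ \<Rightarrow> p | Inr (Inl _) \<Rightarrow> p | Inr (Inr _) \<Rightarrow> q"
  show "(case i of Inl _ \<Rightarrow> S | Inr (Inl _) \<Rightarrow> S | Inr (Inr _) \<Rightarrow> T) \<in> loc_unif_closure (scalar_nets \<rho> (?k i))" for i
    using S T by (auto split: sum.split)
  show "(\<Sum>i\<in>UNIV. ?k i) \<le> W" using W by (simp add: sum_UNIV_sum mult.commute)
qed

text \<open>A single affine map adds a multiple of the scratch value to the accumulator and also
  overwrites the scratch, both from the old state. No neurons are spent on either update.\<close>

lemma affine_map_pack:
  "affine_map (\<lambda>i j. case i of
       Inl k \<Rightarrow> (case j of Inl l \<Rightarrow> if l = k then 1 else 0 | Inr _ \<Rightarrow> 0)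
     | Inr (Inl k) \<Rightarrow> (case j of Inl _ \<Rightarrow> 0 | Inr (Inl l) \<Rightarrow> if l = k then 1 else 0 | Inr (Inr _) \<Rightarrow> w $ k)
     | Inr (Inr _) \<Rightarrow> (case j of Inl l \<Rightarrow> a l | Inr (Inl _) \<Rightarrow> 0 | Inr (Inr _) \<Rightarrow> \<alpha>))
     (\<lambda>i. case i of Inl _ \<Rightarrow> 0 | Inr (Inl _) \<Rightarrow> 0 | Inr (Inr _) \<Rightarrow> \<beta>) (pack x y r)
   = pack x (y + r *s w) ((\<Sum>j\<in>UNIV. a j * x $ j) + \<alpha> * r + \<beta>)"
  by (auto simp: affine_map_def pack_def vec_eq_iff sum_UNIV_sum if_distrib[where f = "\<lambda>t. t * _"] mult.commute[of _ r]
      cong: if_cong split: sum.split)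

text \<open>Only the available gates are assumed, not how the registers are carried through a layer,
  so both width bounds share one argument. \<open>Q\<close> is specified on the reals alone;
  \<open>real_part\<close> provides real arguments for it.\<close>

locale register_machine =
  fixes \<rho> :: "complex \<Rightarrow> complex" and W :: nat and Q :: "complex \<Rightarrow> complex"
    and typ_n :: "'n::finite itself" and typ_m :: "'m::finite itself"
  assumes keep: "(on_registers (\<lambda>z. z) (\<lambda>z. z) :: _ \<Rightarrow> complex ^ ('n + 'm + unit)) \<in> loc_unif_closure (NN \<rho> W)"
    and real_part: "(on_registers (\<lambda>z. z) (\<lambda>z. of_real (Re z)) :: _ \<Rightarrow> complex ^ ('n + 'm + unit)) \<in> loc_unif_closure (NN \<rho> W)"
    and quadratic: "(on_registers (\<lambda>z. z) Q :: _ \<Rightarrow> complex ^ ('n + 'm + unit)) \<in> loc_unif_closure (NN \<rho> W)"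
    and Q_real: "Q (of_real t) = of_real (t\<^sup>2)"
begin

definition reach :: "(complex ^ 'n \<Rightarrow> complex ^ 'm) \<Rightarrow> (complex ^ 'n \<Rightarrow> complex) \<Rightarrow> bool" where
  "reach Y R \<longleftrightarrow> (\<lambda>x. pack x (Y x) (R x)) \<in> loc_unif_closure (NN \<rho> W)"

text \<open>Loading the input is affine, but a network has at least one hidden layer; composing with
  \<open>keep\<close> provides it.\<close>

lemma reach_zero: "reach (\<lambda>x. 0) (\<lambda>x. 0)"
proof -
  have "affine_map (\<lambda>i j. case i of Inl k \<Rightarrow> if j = k then 1 else 0 | Inr _ \<Rightarrow> 0) (\<lambda>_. 0) x = pack x (0 :: complex ^ 'm) 0"
    for x :: "complex ^ 'n"
    by (auto simp: affine_map_def pack_def vec_eq_iff if_distrib[where f = "\<lambda>t. t * _"] cong: if_cong split: sum.split)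
  then show ?thesis
    using loc_unif_NN_compose_affine_map[OF keep, of "\<lambda>i j. case i of Inl k \<Rightarrow> if j = k then 1 else 0 | Inr _ \<Rightarrow> 0" "\<lambda>_. 0"]
    by (simp add: reach_def comp_def on_registers_id_pack)
qed

lemma reach_affine:
  assumes "reach Y R"
  shows "reach (\<lambda>x. Y x + R x *s w) (\<lambda>x. (\<Sum>j\<in>UNIV. a j * x $ j) + \<alpha> * R x + \<beta>)"
  unfolding reach_def affine_map_pack[symmetric]
  using affine_map_compose_loc_unif_NN[OF assms[unfolded reach_def]] by (simp add: comp_def)

lemma reach_apply:
  assumes "reach Y R" "(on_registers (\<lambda>z. z) T :: _ \<Rightarrow> complex ^ ('n + 'm + unit)) \<in> loc_unif_closure (NN \<rho> W)"
  shows "reach Y (\<lambda>x. T (R x))"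
  using loc_unif_NN_compose[OF assms(1)[unfolded reach_def] assms(2)]
  by (simp add: reach_def comp_def on_registers_id_pack)

lemma reach_power:
  assumes "reach Y (\<lambda>x. of_real (t x))"
  shows "reach Y (\<lambda>x. of_real (t x ^ (2 ^ k)))"
proof (induction k)
  case 0
  then show ?case using assms by simp
next
  case (Suc k)
  show ?case using reach_apply[OF Suc quadratic]
    by (simp only: Q_real) (simp add: power_mult[symmetric] mult.commute)
qed

text \<open>An affine step turns t into 1 + t/N, and with N = 2^k, squaring k times yields the N-th
  power. Each such state is itself only a limit of networks, so the result lies in the closure of
  the closure.\<close>

lemma reach_exp:
  assumes Y: "reach Y (\<lambda>x. of_real (t x))"
  shows "reach Y (\<lambda>x. of_real (exp (t x)))"
proof -
  \<comment> \<open>Continuity of \<open>Y\<close> and \<open>t\<close> is read off from the entries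
    of the packed map; it is needed for continuity of the new limit.\<close>
  have cont: "continuous_on UNIV (\<lambda>x. pack x (Y x) (of_real (t x)))"
    using Y unfolding reach_def by (rule loc_unif_continuous)
  have contY: "continuous_on UNIV (\<lambda>x. Y x $ i)" for i
    using continuous_on_component[OF cont, of "Inr (Inl i)"] by (simp add: pack_def)
  have contt: "continuous_on UNIV t"
    using continuous_on_Re[OF continuous_on_component[OF cont, of "Inr (Inr ())"]] by (simp add: pack_def)
  have "continuous_on UNIV (\<lambda>x. pack x (Y x) (of_real (exp (t x))) $ i)" for i
  proof (cases i)
    case (Inr j)
    then show ?thesis using contY contt by (cases j) (auto simp: pack_def intro!: continuous_intros)
  qed (auto simp: pack_def intro!: continuous_intros)
  then have cont': "continuous_on UNIV (\<lambda>x. pack x (Y x) (of_real (exp (t x))))"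
    using continuous_on_vec_lambda[of UNIV "\<lambda>i x. pack x (Y x) (of_real (exp (t x))) $ i"] by simp
  have "(\<lambda>x. pack x (Y x) (of_real (exp (t x)))) \<in> loc_unif_closure (loc_unif_closure (NN \<rho> W))"
  proof (rule loc_unif_closureI[OF cont'])
    fix K :: "(complex ^ 'n) set" and \<epsilon> :: real assume K: "compact K" and e: "\<epsilon> > 0"
    have "compact (t ` K)" using K contt compact_continuous_image continuous_on_subset by blast
    then obtain R where R: "\<And>x. x \<in> K \<Longrightarrow> \<bar>t x\<bar> \<le> R"
      using compact_imp_bounded bounded_iff by (metis imageI real_norm_def)
    \<comment> \<open>As 2^k is at least k, making k large secures both the hypothesis of
      \<open>exp_limit_bound\<close> and an error below \<epsilon>.\<close>
    obtain k where k: "real k > max (2 * R) (exp R * (2 * R\<^sup>2) / \<epsilon>)" using reals_Archimedean2 by blast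
    define N :: nat where "N = 2 ^ k"
    have kN: "real k \<le> real N" unfolding N_def by (simp add: less_imp_le)
    have N: "N > 0" "2 * R \<le> real N" "exp R * (2 * R\<^sup>2) / real N < \<epsilon>"
    proof -
      show N0: "N > 0" by (simp add: N_def)
      show "2 * R \<le> real N" using k kN by simp
      have "exp R * (2 * R\<^sup>2) / \<epsilon> < real N" using k kN by simp
      then show "exp R * (2 * R\<^sup>2) / real N < \<epsilon>" using e N0 by (simp add: field_simps)
    qed
    have "reach Y (\<lambda>x. of_real (1 + t x / real N))"
      using reach_affine[OF Y, of 0 "\<lambda>_. 0" "1 / of_nat N" 1] by (simp add: add.commute)
    then have mem: "(\<lambda>x. pack x (Y x) (of_real ((1 + t x / real N) ^ N))) \<in> loc_unif_closure (NN \<rho> W)"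
      using reach_power[of Y "\<lambda>x. 1 + t x / real N" k] unfolding reach_def N_def by blast
    have "norm (pack x (Y x) (of_real ((1 + t x / real N) ^ N)) - pack x (Y x) (of_real (exp (t x)))) < \<epsilon>"
      if x: "x \<in> K" for x
    proof -
      have "norm (complex_of_real ((1 + t x / real N) ^ N) - of_real (exp (t x))) =
          \<bar>(1 + t x / real N) ^ N - exp (t x)\<bar>"
        unfolding of_real_diff[symmetric] norm_of_real ..
      then show ?thesis unfolding pack_diff norm_pack_zero
        using exp_limit_bound[OF R[OF x] N(1,2)] N(3) by linarith
    qed
    then show "\<exists>g\<in>loc_unif_closure (NN \<rho> W). \<forall>x\<in>K. norm (g x - pack x (Y x) (of_real (exp (t x)))) < \<epsilon>"
      by (intro bexI[OF _ mem]) blast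
  qed
  then show ?thesis using loc_unif_closure_idem unfolding reach_def by blast
qed

text \<open>An exponential is computed afresh from the stored input and then added to the
  accumulator; sums are processed one after the other and scalars move into \<open>w\<close>. Both
  \<open>Y\<close> and \<open>w\<close> must vary in the induction. The scratch content left behind
  is irrelevant, hence the existential quantifier.\<close>

lemma reach_add_exp_span:
  assumes "g \<in> exp_span" "\<exists>R. reach Y R"
  shows "\<exists>R. reach (\<lambda>x. Y x + of_real (g x) *s w) R"
  using assms
proof (induction arbitrary: Y w)
  case (exp a)
  then obtain R where R: "reach Y R" by blast
  have "reach Y (\<lambda>x. \<Sum>j\<in>UNIV. a j * x $ j)"
    \<comment> \<open>Taking \<alpha> = 0 erases the old scratch value, and \<open>w = 0\<close>
      leaves the accumulator unchanged.\<close>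
    using reach_affine[OF R, of 0 a 0 0] by simp
  from reach_exp[OF reach_apply[OF this real_part]]
  show ?case using reach_affine by blast
next
  case (add f g)
  have "\<exists>R. reach (\<lambda>x. (Y x + of_real (f x) *s w) + of_real (g x) *s w) R"
    using add by blast
  then show ?case by (simp add: vector_sadd_rdistrib add.assoc)
next
  case (scale f c)
  have "\<exists>R. reach (\<lambda>x. Y x + of_real (f x) *s (of_real c *s w)) R"
    using scale by blast
  then show ?case by (simp add: vector_smult_assoc mult.commute)
qed

lemma reach_sum_exp_span:
  assumes "finite I" "\<And>i. i \<in> I \<Longrightarrow> g i \<in> exp_span"
  shows "\<exists>R. reach (\<lambda>x. \<Sum>i\<in>I. of_real (g i x) *s w i) R"
  using assms
proof (induction rule: finite_induct)
  case empty
  show ?case using reach_zero by auto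
next
  case (insert i I)
  then show ?case using reach_add_exp_span[of "g i" "\<lambda>x. \<Sum>i\<in>I. of_real (g i x) *s w i" "w i"]
    by (simp add: add.commute)
qed

lemma reach_imp_loc_unif:
  assumes "reach Y R"
  shows "Y \<in> loc_unif_closure (NN \<rho> W)"
proof -
  let ?A = "\<lambda>(i::'m) (j::'n + 'm + unit). case j of Inl _ \<Rightarrow> 0 | Inr (Inl k) \<Rightarrow> if k = i then 1 else 0 | Inr (Inr _) \<Rightarrow> 0"
  have "affine_map ?A (\<lambda>_. 0) (pack x y r) = y" for x y r
    by (simp add: affine_map_def pack_def vec_eq_iff sum_UNIV_sum if_distrib[where f = "\<lambda>t. t * _"] cong: if_cong)
  then show ?thesis
    using affine_map_compose_loc_unif_NN[OF assms[unfolded reach_def], of ?A "\<lambda>_. 0"] by (simp add: comp_def)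
qed

lemma universal_NN: "universal (NN \<rho> W :: (complex ^ 'n \<Rightarrow> complex ^ 'm) set)"
  unfolding universal_iff_loc_unif
proof (intro allI impI)
  fix g :: "complex ^ 'n \<Rightarrow> complex ^ 'm" assume g: "continuous_on UNIV g"
  have "g \<in> loc_unif_closure (loc_unif_closure (NN \<rho> W))"
  proof (rule loc_unif_closureI[OF g])
    fix K :: "(complex ^ 'n) set" and \<epsilon> :: real assume K: "compact K" and e: "\<epsilon> > 0"
    \<comment> \<open>Each of the CARD('m) entries has a real and an imaginary error below
      \<open>d\<close>.\<close>
    define d where "d = \<epsilon> / (2 * real CARD('m))"
    have d: "d > 0" using e by (simp add: d_def)
    have gK: "continuous_on K g" using g continuous_on_subset by blast
    have "\<exists>p\<in>exp_span. \<forall>x\<in>K. \<bar>Re (g x $ i) - p x\<bar> < d" for i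
      using exp_span_dense[OF K _ d, of "\<lambda>x. Re (g x $ i)"] gK
      by (metis continuous_on_Re continuous_on_component)
    then obtain p where p: "\<And>i. p i \<in> exp_span" "\<And>i x. x \<in> K \<Longrightarrow> \<bar>Re (g x $ i) - p i x\<bar> < d" by metis
    have "\<exists>q\<in>exp_span. \<forall>x\<in>K. \<bar>Im (g x $ i) - q x\<bar> < d" for i
      using exp_span_dense[OF K _ d, of "\<lambda>x. Im (g x $ i)"] gK
      by (metis continuous_on_Im continuous_on_component)
    then obtain q where q: "\<And>i. q i \<in> exp_span" "\<And>i x. x \<in> K \<Longrightarrow> \<bar>Im (g x $ i) - q i x\<bar> < d" by metis
    \<comment> \<open>The index type \<open>'m + 'm\<close> lists real and imaginary parts
      separately; the latter are accumulated along i times the unit vectors.\<close>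
    define Y where "Y x = (\<Sum>i\<in>UNIV. of_real (case_sum p q i x) *s
        (case i of Inl k \<Rightarrow> axis k 1 | Inr k \<Rightarrow> axis k \<i>))" for x
    have "\<exists>R. reach Y R"
      unfolding Y_def using p(1) q(1) by (intro reach_sum_exp_span) (auto split: sum.split)
    then have mem: "Y \<in> loc_unif_closure (NN \<rho> W)" using reach_imp_loc_unif by blast
    have Yi: "Y x $ i = Complex (p i x) (q i x)" for x i
      by (simp add: Y_def sum_UNIV_sum axis_def if_distrib[where f = "\<lambda>t. _ * t"] complex_eq_iff cong: if_cong)
    have "norm (Y x - g x) < \<epsilon>" if x: "x \<in> K" for x
    proof -
      have *: "norm ((Y x - g x) $ i) < 2 * d" for i
        using cmod_le[of "(Y x - g x) $ i"] p(2)[OF x, of i] q(2)[OF x, of i] by (simp add: Yi abs_minus_commute)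
      have "norm (Y x - g x) \<le> (\<Sum>i\<in>UNIV. norm ((Y x - g x) $ i))"
        unfolding norm_vec_def by (rule L2_set_le_sum) auto
      also have "\<dots> < (\<Sum>i\<in>(UNIV::'m set). 2 * d)" using * by (intro sum_strict_mono) auto
      also have "\<dots> = \<epsilon>" by (simp add: d_def)
      finally show ?thesis .
    qed
    then show "\<exists>h\<in>loc_unif_closure (NN \<rho> W). \<forall>x\<in>K. norm (h x - g x) < \<epsilon>" using mem by blast
  qed
  then show "g \<in> loc_unif_closure (NN \<rho> W)" using loc_unif_closure_idem by blast
qed

end

text \<open>If a single neuron only yields conjugation, two layers restore the carried registers.\<close>
lemma on_registers_cnj_cnj: "on_registers cnj S \<circ> on_registers cnj T = on_registers (\<lambda>z. z) (S \<circ> T)"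
  by (auto simp: on_registers_def fun_eq_iff vec_eq_iff split: sum.split)

section \<open>Gates obtained from the hypotheses on \<rho>, and the two width bounds\<close>

lemma C2_real_scalar_nets:
  assumes "C2_real \<rho>" "\<not> \<rho> holomorphic_on UNIV" "\<not> antiholomorphic \<rho>" "\<not> R_affine \<rho>"
  obtains Q where "(\<lambda>z. z) \<in> loc_unif_closure (scalar_nets \<rho> 2)" "(\<lambda>z. of_real (Re z)) \<in> loc_unif_closure (scalar_nets \<rho> 4)"
    "Q \<in> loc_unif_closure (scalar_nets \<rho> 2)" "\<forall>t. Q (of_real t) = of_real (t\<^sup>2)"
proof -
  obtain f' :: "complex \<Rightarrow> complex \<Rightarrow>\<^sub>L complex" and f'' :: "complex \<Rightarrow> complex \<Rightarrow>\<^sub>L complex \<Rightarrow>\<^sub>L complex"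
    where f: "\<And>z. (\<rho> has_derivative blinfun_apply (f' z)) (at z)"
      and f': "\<And>z. (f' has_derivative blinfun_apply (f'' z)) (at z)"
    using assms(1) unfolding C2_real_def by blast
  obtain z1 where "wirt \<rho> z1 \<noteq> 0" using ex_wirt_nonzero[OF f assms(3)] .
  then have id: "(\<lambda>z. z) \<in> loc_unif_closure (scalar_nets \<rho> 2)" by (rule id_in_loc_unif_scalar_nets_2[OF f])
  obtain z2 where "cowirt \<rho> z2 \<noteq> 0" using ex_cowirt_nonzero[OF f assms(2)] .
  then have "cnj \<in> loc_unif_closure (scalar_nets \<rho> 2)" by (rule cnj_in_loc_unif_scalar_nets_2[OF f])
  \<comment> \<open>Re z is the mean of z and its conjugate, at two neurons each.\<close>
  from loc_unif_scalar_nets_lincomb[OF id this, of "1 / 2" "1 / 2"]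
  have re: "(\<lambda>z. of_real (Re z)) \<in> loc_unif_closure (scalar_nets \<rho> 4)"
    by (simp add: complex_add_cnj add_divide_distrib[symmetric])
  obtain z v where zv: "f'' z v v \<noteq> 0"
    using R_affine_if_second_deriv_vanishes[OF f f'] assms(4) by blast
  \<comment> \<open>Real factors leave the real-bilinear form \<open>f'' z\<close> as squares, so
    dividing by its value at \<open>v\<close> makes \<open>Q\<close> the square on the
    reals.\<close>
  define Q where "Q w = (1 / f'' z v v) * f'' z (v * w) (v * w)" for w
  have "Q \<in> loc_unif_closure (scalar_nets \<rho> 2)"
    unfolding Q_def by (rule second_deriv_in_loc_unif_scalar_nets[OF f f'])
  moreover have "Q (of_real t) = of_real (t\<^sup>2)" for t
  proof -
    have tv: "v * of_real t = t *\<^sub>R v" by (simp add: scaleR_conv_of_real)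
    have "f'' z (v * of_real t) (v * of_real t) = of_real (t\<^sup>2) * f'' z v v"
      unfolding tv blinfun.bilinear_simps
      by (simp add: scaleR_conv_of_real power2_eq_square)
    then show ?thesis using zv by (simp add: Q_def)
  qed
  ultimately show ?thesis using that id re by blast
qed

theorem theorem5p3:
  fixes \<rho> :: "complex \<Rightarrow> complex"
  assumes "C2_real \<rho>"
    and "\<not> \<rho> holomorphic_on UNIV"
    and "\<not> antiholomorphic \<rho>"
    and "\<not> R_affine \<rho>"
  shows "universal (NN \<rho> (2 * CARD('n::finite) + 2 * CARD('m::finite) + 5)
                     :: (complex ^ 'n \<Rightarrow> complex ^ 'm) set)
    \<and> ((\<exists>z0. (wirt \<rho> z0 \<noteq> 0 \<and> cowirt \<rho> z0 = 0) \<or> (wirt \<rho> z0 = 0 \<and> cowirt \<rho> z0 \<noteq> 0))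
        \<longrightarrow> universal (NN \<rho> (CARD('n) + CARD('m) + 4)
                        :: (complex ^ 'n \<Rightarrow> complex ^ 'm) set))"
proof (intro conjI impI)
  obtain Q where id: "(\<lambda>z. z) \<in> loc_unif_closure (scalar_nets \<rho> 2)"
    and re: "(\<lambda>z. of_real (Re z)) \<in> loc_unif_closure (scalar_nets \<rho> 4)"
    and Q: "Q \<in> loc_unif_closure (scalar_nets \<rho> 2)" and Qt: "\<forall>t. Q (of_real t) = of_real (t\<^sup>2)"
    by (rule C2_real_scalar_nets[OF assms])
  \<comment> \<open>The real part is the most expensive gate with four neurons; the others are
    padded to the same size, so the scratch register always takes four.\<close>
  have id4: "(\<lambda>z. z) \<in> loc_unif_closure (scalar_nets \<rho> 4)" and Q4: "Q \<in> loc_unif_closure (scalar_nets \<rho> 4)"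
    using loc_unif_scalar_nets_mono[OF id] loc_unif_scalar_nets_mono[OF Q] by simp_all
  show "universal (NN \<rho> (2 * CARD('n) + 2 * CARD('m) + 5) :: (complex ^ 'n \<Rightarrow> complex ^ 'm) set)"
  proof -
    interpret register_machine \<rho> "2 * CARD('n) + 2 * CARD('m) + 5" Q "TYPE('n)" "TYPE('m)"
      by unfold_locales (auto intro!: on_registers_in_loc_unif_NN[OF id] id4 re Q4 simp: Qt simp del: of_real_power)
    show ?thesis by (rule universal_NN)
  qed
  let ?W = "CARD('n) + CARD('m) + 4"
  assume "\<exists>z0. (wirt \<rho> z0 \<noteq> 0 \<and> cowirt \<rho> z0 = 0) \<or> (wirt \<rho> z0 = 0 \<and> cowirt \<rho> z0 \<noteq> 0)"
  then obtain z0 where z0: "(wirt \<rho> z0 \<noteq> 0 \<and> cowirt \<rho> z0 = 0) \<or> (wirt \<rho> z0 = 0 \<and> cowirt \<rho> z0 \<noteq> 0)" ..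
  obtain D where D: "(\<rho> has_derivative D) (at z0)" using assms(1) unfolding C2_real_def by blast
  have regs: "(on_registers (\<lambda>z. z) T :: _ \<Rightarrow> complex ^ ('n + 'm + unit)) \<in> loc_unif_closure (NN \<rho> ?W)"
    if T: "T \<in> loc_unif_closure (scalar_nets \<rho> 4)" for T
    using z0
  proof
    assume "wirt \<rho> z0 \<noteq> 0 \<and> cowirt \<rho> z0 = 0"
    then have "(\<lambda>z. z) \<in> loc_unif_closure (scalar_nets \<rho> 1)" using id_in_loc_unif_scalar_nets_1[OF D] by blast
    then show ?thesis using T by (rule on_registers_in_loc_unif_NN) simp
  next
    assume "wirt \<rho> z0 = 0 \<and> cowirt \<rho> z0 \<noteq> 0"
    then have "cnj \<in> loc_unif_closure (scalar_nets \<rho> 1)" using cnj_in_loc_unif_scalar_nets_1[OF D] by blast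
    then have *: "(on_registers cnj T :: _ \<Rightarrow> complex ^ ('n + 'm + unit)) \<in> loc_unif_closure (NN \<rho> ?W)"
      if "T \<in> loc_unif_closure (scalar_nets \<rho> 4)" for T using that by (rule on_registers_in_loc_unif_NN) simp
    \<comment> \<open>The first layer conjugates the carried registers and preserves the scratch;
      the second conjugates them back while applying \<open>T\<close>.\<close>
    show ?thesis
      using loc_unif_NN_compose[OF *[OF id4] *[OF T]] unfolding on_registers_cnj_cnj by (simp add: comp_def)
  qed
  interpret register_machine \<rho> ?W Q "TYPE('n)" "TYPE('m)"
    by unfold_locales (simp_all add: regs id4 re Q4 Qt del: of_real_power)
  show "universal (NN \<rho> ?W :: (complex ^ 'n \<Rightarrow> complex ^ 'm) set)" by (rule universal_NN)
qed

end
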